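(* Let $L$ be a finite set of positive integers with $\gcd\{k:k\in L\}=1$. Let $l=\min L$ and assume $l>1$. Let $m=\lfloor l/2\rfloor$, and for each $1\le j\le m$ let $$l_j=\min\{k\in L: jk\not\equiv0\pmod l\}.$$ Fix $u\in\{l_1,l_2,\dots,l_m\}$, and for $t\ge0$ let $$\gamma_j=\gamma_j(t)=\begin{cases}0&\text{if } l_j>u,\\ t&\text{if } l_j=u,\\ \infty&\text{if } l_j<u.\end{cases}$$ Let $\theta_j=2\pi j/l$, let $s$ be an integer, and define $$\psi_j(s,t)=\begin{cases}(-1)^se^{-2\gamma_m}&\text{if } l\text{ is even and }j=m,\\ 2e^{-\gamma_j(1-\cos(l_j\theta_j))}\cos\left(s\theta_j-\gamma_j\sin(l_j\theta_j)\right)&\text{in all other cases},\end{cases}$$ with the convention $e^{-\infty}=0$ (so $\psi_j(s,t)=0$ whenever $\gamma_j=\infty$). Then $$1+\sum_{j=1}^m\psi_j(s,t)\ge0$$ for all real $t\ge0$ and all integers $s$.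
   Context: The integers $l_j$ exist because $\gcd L=1$ and $1\le j\le l/2<l$. By the definition of $l_j$, $1-\cos(l_j\theta_j)>0$. *)

theory Defs
  imports "HOL-Library.Extended_Real" "HOL-Number_Theory.Cong"
begin

(* For 1 <= j <= l div 2 the set under Min is nonempty, because Gcd L = 1 and 0 < j < l. *)
definition ell :: "nat set \<Rightarrow> nat \<Rightarrow> nat" where
  "ell L j = Min {k \<in> L. \<not> [j * k = 0] (mod (Min L))}"

definition gam :: "nat set \<Rightarrow> nat \<Rightarrow> nat \<Rightarrow> real \<Rightarrow> ereal" where
  "gam L u j t =
     (if ell L j > u then 0 else if ell L j = u then ereal t else \<infinity>)"

definition theta :: "nat set \<Rightarrow> nat \<Rightarrow> real" where
  "theta L j = 2 * pi * real j / real (Min L)"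

(* The first case is the convention exp (- \<infinity>) = 0; in the remaining cases
   gam is finite and real_of_ereal returns its value. *)
definition psi :: "nat set \<Rightarrow> nat \<Rightarrow> nat \<Rightarrow> int \<Rightarrow> real \<Rightarrow> real" where
  "psi L u j s t =
     (let l = Min L; m = l div 2; g = real_of_ereal (gam L u j t) in
      if gam L u j t = \<infinity> then 0
      else if even l \<and> j = m then (-1) powi s * exp (- 2 * g)
      else 2 * exp (- g * (1 - cos (real (ell L j) * theta L j)))
             * cos (of_int s * theta L j - g * sin (real (ell L j) * theta L j)))"

end

theory Submission
  imports Defs
begin

text \<open>
  Put \<open>F j = Re (cis (s \<theta>\<^sub>j) * exp (t * (cis (- u \<theta>\<^sub>j) - 1)))\<close>, a function of \<open>j\<close> modulo \<open>l\<close> that is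
  invariant under \<open>j \<mapsto> - j\<close>. If \<open>l\<^sub>j = u\<close>, then \<open>\<psi>\<^sub>j = 2 F j\<close> for \<open>j \<noteq> l / 2\<close>, which accounts for
  the pair \<open>j, l - j\<close>, and \<open>\<psi>\<^sub>j = F j\<close> for \<open>j = l / 2\<close>. The same holds when \<open>l\<^sub>j > u\<close>: then
  \<open>u j \<equiv> 0\<close> modulo \<open>l\<close>, so \<open>cis (- u \<theta>\<^sub>j) = 1\<close> and the parameter \<open>t\<close> has no influence, in agreement
  with \<open>\<gamma>\<^sub>j = 0\<close>. Finally, \<open>l\<^sub>j \<ge> u\<close> says that \<open>l\<close> divides \<open>j k\<close> for all \<open>k \<in> L\<close> below \<open>u\<close>; these
  \<open>j\<close>, their negatives and \<open>0\<close> form a subgroup \<open>H\<close> of the integers modulo \<open>l\<close>, and the other \<open>\<psi>\<^sub>j\<close>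
  vanish. Unfolding the pairs (\<open>sum_fold_reflection\<close>) therefore turns the left hand side into the sum
  of \<open>F\<close> over \<open>H\<close>.

  Expanding the exponential in powers of \<open>t\<close>, this sum equals \<open>exp (- t)\<close> times a power series in
  \<open>t\<close> whose \<open>n\<close>-th coefficient is \<open>1 / n!\<close> times the sum over \<open>H\<close> of the character
  \<open>j \<mapsto> cis ((s - n u) \<theta>\<^sub>j)\<close>. A character sum over a finite group is either \<open>0\<close> or the order of the
  group, so all coefficients are nonnegative (\<open>sum_cos_roots_nonneg\<close>, \<open>sum_poisson_nonneg\<close>).
\<close>

section \<open>Positivity of the sum over a cyclic group\<close>

lemma cis_roots_power:
  "cis (2 * pi * real i / real d * of_int a) = cis (2 * pi * of_int a / real d) ^ i"
  by (simp add: Complex.DeMoivre mult_ac)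

text \<open>
  The cosines are the real parts of the powers of a \<open>d\<close>-th root of unity, and these powers sum to
  \<open>d\<close> if the root is 1 and to 0 otherwise.
\<close>

lemma sum_cos_roots_nonneg:
  fixes a :: int
  assumes "d > 0"
  shows "(\<Sum>i<d. cos (2 * pi * real i / real d * of_int a)) \<ge> 0"
proof -
  define w where "w = cis (2 * pi * of_int a / real d)"
  have "w ^ d = cis (2 * pi * of_int a)"
    using assms by (simp add: w_def Complex.DeMoivre mult_ac)
  hence wd: "w ^ d = 1"
    by (simp add: complex_eq_iff)
  have "(\<Sum>i<d. cos (2 * pi * real i / real d * of_int a)) = Re (\<Sum>i<d. w ^ i)"
    by (simp add: w_def flip: cis_roots_power)
  also have "\<dots> \<ge> 0"
    using wd by (cases "w = 1") (simp_all add: geometric_sum)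
  finally show ?thesis .
qed

text \<open>
  In probabilistic terms, the sum is \<open>d\<close> times the probability that \<open>u N \<equiv> s\<close> modulo \<open>d\<close> for a
  Poisson variable \<open>N\<close> of mean \<open>t\<close>.
\<close>

lemma sum_poisson_nonneg:
  fixes s :: int and d u :: nat and t :: real
  assumes "d > 0" "t \<ge> 0"
  defines "\<phi> \<equiv> \<lambda>i. 2 * pi * real i / real d"
  shows "(\<Sum>i<d. exp (- t * (1 - cos (real u * \<phi> i))) * cos (of_int s * \<phi> i - t * sin (real u * \<phi> i))) \<ge> 0"
proof -
  define z where "z i = of_real t * cis (- (real u * \<phi> i))" for i
  \<comment> \<open>the real part of the \<open>n\<close>-th term of the series of \<open>cis (s \<phi>\<^sub>i) * exp (z i)\<close>\<close>
  define c where "c n i = t ^ n / fact n * cos (\<phi> i * of_int (s - int n * int u))" for n i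
  have "(\<lambda>n. c n i) sums Re (cis (of_int s * \<phi> i) * exp (z i))" for i
  proof -
    have "(\<lambda>n. Re (cis (of_int s * \<phi> i) * (z i ^ n /\<^sub>R fact n))) sums Re (cis (of_int s * \<phi> i) * exp (z i))"
      by (intro sums_Re sums_mult exp_converges)
    moreover have "Re (cis (of_int s * \<phi> i) * (z i ^ n /\<^sub>R fact n)) = c n i" for n
    proof -
      have "cis (of_int s * \<phi> i) * (z i ^ n /\<^sub>R fact n) =
            of_real (t ^ n / fact n) * cis (\<phi> i * of_int (s - int n * int u))"
        by (simp add: z_def power_mult_distrib Complex.DeMoivre cis_mult scaleR_conv_of_real
              algebra_simps divide_inverse)
      thus ?thesis
        by (simp add: c_def del: of_real_divide of_real_power)
    qed
    ultimately show ?thesis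
      by simp
  qed
  hence "(\<lambda>n. \<Sum>i<d. c n i) sums (\<Sum>i<d. Re (cis (of_int s * \<phi> i) * exp (z i)))"
    by (intro sums_sum) auto
  moreover have "(\<Sum>i<d. c n i) \<ge> 0" for n
    unfolding c_def \<phi>_def sum_distrib_left[symmetric]
    using assms(2) by (intro mult_nonneg_nonneg sum_cos_roots_nonneg[OF assms(1)] divide_nonneg_nonneg zero_le_power fact_ge_zero)
  ultimately have "(\<Sum>i<d. Re (cis (of_int s * \<phi> i) * exp (z i))) \<ge> 0"
    by (rule sums_le[OF _ sums_zero, rotated])
  hence "exp (- t) * (\<Sum>i<d. Re (cis (of_int s * \<phi> i) * exp (z i))) \<ge> 0"
    by simp
  also have "exp (- t) * (\<Sum>i<d. Re (cis (of_int s * \<phi> i) * exp (z i))) =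
    (\<Sum>i<d. exp (- t * (1 - cos (real u * \<phi> i))) * cos (of_int s * \<phi> i - t * sin (real u * \<phi> i)))"
    unfolding sum_distrib_left
  proof (intro sum.cong refl)
    fix i
    have "exp (- t * (1 - cos (real u * \<phi> i))) = exp (- t) * exp (t * cos (real u * \<phi> i))"
      by (simp add: algebra_simps flip: exp_add)
    thus "exp (- t) * Re (cis (of_int s * \<phi> i) * exp (z i)) =
      exp (- t * (1 - cos (real u * \<phi> i))) * cos (of_int s * \<phi> i - t * sin (real u * \<phi> i))"
      by (simp add: z_def Re_exp Im_exp cos_diff algebra_simps)
  qed
  finally show ?thesis .
qed

section \<open>Folding and reindexing\<close>

lemma sum_fold_reflection:
  fixes G :: "nat \<Rightarrow> real"
  assumes "l > 0" and refl: "\<And>j. 0 < j \<Longrightarrow> j < l \<Longrightarrow> G (l - j) = G j"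
  shows "(\<Sum>j<l. G j) = G 0 + (\<Sum>j=1..l div 2. if even l \<and> j = l div 2 then G j else 2 * G j)"
proof -
  define m where "m = l div 2"
  have "{..<l} = insert 0 ({1..m} \<union> {m<..<l})"
    using assms(1) by (auto simp: m_def)
  hence "(\<Sum>j<l. G j) = G 0 + ((\<Sum>j=1..m. G j) + (\<Sum>j\<in>{m<..<l}. G j))"
    by (simp add: sum.union_disjoint Int_def)
  also have "(\<Sum>j\<in>{m<..<l}. G j) = (\<Sum>j\<in>{1..<l - m}. G j)"
    by (rule sum.reindex_bij_witness[of _ "\<lambda>j. l - j" "\<lambda>j. l - j"])
       (auto simp: refl)
  also have "{1..<l - m} = {j \<in> {1..m}. \<not> (even l \<and> j = m)}"
    by (auto simp: m_def elim!: evenE oddE)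
  also have "(\<Sum>j\<in>\<dots>. G j) = (\<Sum>j=1..m. if \<not> (even l \<and> j = m) then G j else 0)"
    by (intro sum.inter_filter) auto
  also have "(\<Sum>j=1..m. G j) + \<dots> = (\<Sum>j=1..m. if even l \<and> j = m then G j else 2 * G j)"
    unfolding sum.distrib[symmetric] by (intro sum.cong) auto
  finally show ?thesis
    by (simp add: m_def)
qed

text \<open>
  The subgroup of the integers modulo \<open>l\<close> killed by \<open>d\<close> is generated by \<open>l div d\<close>.
\<close>

lemma sum_torsion_reindex:
  fixes G :: "nat \<Rightarrow> real"
  assumes "d dvd l" "l > 0"
  shows "(\<Sum>j<l. if l dvd j * d then G j else 0) = (\<Sum>i<d. G (i * (l div d)))"
proof -
  obtain q where l: "l = d * q"
    using assms(1) by blast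
  have pos: "d > 0" "q > 0"
    using assms(2) l by auto
  have "l dvd j * d \<longleftrightarrow> q dvd j" for j
    using pos by (simp add: l mult.commute)
  hence "(\<Sum>j<l. if l dvd j * d then G j else 0) = (\<Sum>j\<in>{j \<in> {..<l}. q dvd j}. G j)"
    by (simp only: sum.inter_filter[OF finite_lessThan])
  also have "\<dots> = (\<Sum>i<d. G (i * q))"
    by (rule sum.reindex_bij_witness[of _ "\<lambda>i. i * q" "\<lambda>j. j div q"])
       (use pos in \<open>auto simp: l div_less_iff_less_mult\<close>)
  finally show ?thesis
    using pos by (simp add: l)
qed

section \<open>The terms as values of an exponential sum\<close>

text \<open>
  If \<open>l\<close> divided \<open>j k\<close> for every \<open>k \<in> L\<close>, it would divide \<open>j * Gcd L = j\<close>, which is smaller than \<open>l\<close>.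
\<close>

lemma ell_set:
  assumes "finite L" "Gcd L = 1" "l = Min L" "l > 1" "1 \<le> j" "j \<le> l div 2"
  shows "ell L j = Min {k \<in> L. \<not> l dvd j * k}" "{k \<in> L. \<not> l dvd j * k} \<noteq> {}"
proof -
  show "ell L j = Min {k \<in> L. \<not> l dvd j * k}"
    by (simp add: ell_def assms(3) cong_0_iff)
  show "{k \<in> L. \<not> l dvd j * k} \<noteq> {}"
  proof
    assume "{k \<in> L. \<not> l dvd j * k} = {}"
    hence "l dvd Gcd ((*) j ` L)"
      by (auto intro!: Gcd_greatest)
    hence "l dvd j"
      using assms(2) by (simp add: Gcd_mult)
    thus False
      using assms(4-6) by (auto dest!: dvd_imp_le)
  qed
qed

lemma ell_mem:
  assumes "finite L" "Gcd L = 1" "l = Min L" "l > 1" "1 \<le> j" "j \<le> l div 2"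
  shows "ell L j \<in> L" "\<not> l dvd j * ell L j"
  using Min_in[of "{k \<in> L. \<not> l dvd j * k}"] ell_set[OF assms] assms(1) by auto

text \<open>
  The parameter \<open>\<gamma>\<^sub>j\<close> can be replaced by \<open>t\<close> throughout, at the price of restricting the support to
  the \<open>j\<close> with \<open>l\<^sub>j \<ge> u\<close>. The support is given by divisibility conditions, which are additive in \<open>j\<close>.
\<close>

lemma psi_cases:
  fixes L :: "nat set" and u j :: nat and t :: real and s :: int
  assumes "finite L" "Gcd L = 1" "l = Min L" "l > 1"
    and j: "1 \<le> j" "j \<le> l div 2" and "u \<in> L"
  defines "F \<equiv> exp (- t * (1 - cos (real u * theta L j))) * cos (of_int s * theta L j - t * sin (real u * theta L j))"
  defines "G \<equiv> if \<forall>k\<in>{k\<in>L. k < u}. l dvd j * k then F else 0"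
  shows "psi L u j s t = (if even l \<and> j = l div 2 then G else 2 * G)"
proof -
  define A where "A = {k \<in> L. \<not> l dvd j * k}"
  have ell: "ell L j = Min A" and "A \<noteq> {}"
    using ell_set[OF assms(1-4) j] by (simp_all add: A_def)
  have "finite A"
    using assms(1) by (simp add: A_def)
  have mem: "ell L j \<in> A"
    using \<open>finite A\<close> \<open>A \<noteq> {}\<close> by (simp add: ell)
  have G: "G = (if u \<le> ell L j then F else 0)"
    using \<open>finite A\<close> \<open>A \<noteq> {}\<close> by (auto simp: G_def ell A_def not_le not_less)
  have theta_eq: "theta L j = 2 * pi * real j / real l"
    by (simp add: theta_def assms(3))
  have half: "theta L j = pi" "cos (of_int s * pi) = (-1) powi s" if "even l \<and> j = l div 2"
    using that assms(4) cos_npi_int[of s]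
    by (auto simp: theta_eq power_int_minus_left mult.commute elim!: evenE)
  consider "ell L j < u" | "ell L j = u" | "ell L j > u"
    by linarith
  thus ?thesis
  proof cases
    case 1
    hence "G = 0"
      by (simp add: G)
    with 1 show ?thesis
      by (simp add: psi_def gam_def)
  next
    case 2
    show ?thesis
    proof (cases "even l \<and> j = l div 2")
      case True
      have "odd u"
        using mem 2 True by (auto simp: A_def elim!: evenE)
      hence "F = (-1) powi s * exp (- 2 * t)"
        by (simp add: F_def half[OF True])
      thus ?thesis
        using 2 True by (simp add: psi_def gam_def G assms(3))
    next
      case False
      thus ?thesis
        using 2 by (auto simp: psi_def gam_def G F_def assms(3))
    qed
  next
    case 3
    \<comment> \<open>Here \<open>u * theta L j\<close> is a multiple of \<open>2 * pi\<close>, so that \<open>F\<close> has the same value for all \<open>t\<close>.\<close>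
    have "u \<notin> A"
      using 3 Min_le[OF \<open>finite A\<close>, of u] unfolding ell by (meson leD)
    hence "l dvd j * u"
      using \<open>u \<in> L\<close> by (simp add: A_def)
    then obtain n where n: "j * u = l * n"
      by blast
    have "real u * theta L j = 2 * pi * real (j * u) / real l"
      by (simp add: theta_eq)
    also have "\<dots> = 2 * pi * of_int (int n)"
      using assms(4) by (simp add: n)
    finally have *: "cos (real u * theta L j) = 1" "sin (real u * theta L j) = 0"
      by (simp_all only: cos_int_2pin sin_int_2pin)
    have F: "F = cos (of_int s * theta L j)"
      by (simp add: F_def *)
    show ?thesis
    proof (cases "even l \<and> j = l div 2")
      case True
      have "F = (-1) powi s"
        by (simp add: F half[OF True])
      thus ?thesis
        using 3 True by (simp add: psi_def gam_def G assms(3))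
    next
      case False
      thus ?thesis
        using 3 by (auto simp: psi_def gam_def G F assms(3))
    qed
  qed
qed

theorem proposition3:
  fixes L :: "nat set" and l m u :: nat and t :: real and s :: int
  assumes "finite L" and "\<forall>k\<in>L. k > 0" and "Gcd L = 1"
    and "l = Min L" and "l > 1" and "m = l div 2"
    and "u \<in> ell L ` {1..m}"
    and "t \<ge> 0"
  shows "1 + (\<Sum>j=1..m. psi L u j s t) \<ge> 0"
proof -
  define K where "K = {k \<in> L. k < u}"
  define d where "d = Gcd K"
  define F where "F j = exp (- t * (1 - cos (real u * theta L j))) *
    cos (of_int s * theta L j - t * sin (real u * theta L j))" for j
  define G where "G j = (if l dvd j * d then F j else 0)" for j
  have "L \<noteq> {}"
    using assms(3) by auto
  hence "l \<in> L"
    using assms(1,4) by simp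
  obtain j0 where j0: "1 \<le> j0" "j0 \<le> m" "u = ell L j0"
    using assms(7) by auto
  have u: "u \<in> L" "\<not> l dvd j0 * u"
    using ell_mem[OF assms(1,3,4,5) j0(1)] j0 assms(6) by simp_all
  have "l \<le> u"
    using u(1) assms(1,4) by simp
  moreover have "l \<noteq> u"
    using u(2) by auto
  ultimately have "l \<in> K"
    using \<open>l \<in> L\<close> by (simp add: K_def)
  hence "d dvd l"
    by (simp add: d_def)
  hence d: "d dvd l" "d > 0"
    using assms(5) dvd_pos_nat[of l d] by simp_all
  \<comment> \<open>The support of \<open>G\<close> is the subgroup of the integers modulo \<open>l\<close> killed by the single divisor \<open>d\<close>.\<close>
  have dvd_iff: "(\<forall>k\<in>K. l dvd j * k) \<longleftrightarrow> l dvd j * d" for j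
    using dvd_Gcd_iff[of l "(*) j ` K"] by (simp add: d_def Gcd_mult)
  have "psi L u j s t = (if even l \<and> j = l div 2 then G j else 2 * G j)" if "j \<in> {1..m}" for j
    using psi_cases[OF assms(1,3,4,5) _ _ u(1), of j s t] that
    by (simp add: G_def F_def assms(6) flip: dvd_iff K_def)
  moreover have "G 0 = 1"
    by (simp add: G_def F_def theta_def)
  ultimately have "1 + (\<Sum>j=1..m. psi L u j s t) =
      G 0 + (\<Sum>j=1..l div 2. if even l \<and> j = l div 2 then G j else 2 * G j)"
    by (simp add: assms(6))
  also have "\<dots> = (\<Sum>j<l. G j)"
  proof (rule sum_fold_reflection[symmetric])
    fix j assume j: "0 < j" "j < l"
    have "theta L (l - j) = 2 * pi - theta L j"
      using j by (simp add: theta_def field_simps flip: assms(4))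
    hence mult: "of_int a * theta L (l - j) = 2 * pi * of_int a - of_int a * theta L j" for a
      by (simp only: right_diff_distrib mult_ac)
    have cos_refl: "cos (of_int a * theta L (l - j)) = cos (of_int a * theta L j)"
      and sin_refl: "sin (of_int a * theta L (l - j)) = - sin (of_int a * theta L j)" for a
      unfolding mult by (simp_all add: cos_diff sin_diff)
    have "F (l - j) = F j"
      using cos_refl[of s] sin_refl[of s] cos_refl[of "int u"] sin_refl[of "int u"]
      by (simp add: F_def cos_diff cos_add)
    moreover have "l dvd (l - j) * d \<longleftrightarrow> l dvd j * d"
    proof -
      have "(l - j) * d + j * d = l * d"
        using j by (simp flip: add_mult_distrib)
      thus ?thesis
        by (metis dvd_add_right_iff dvd_add_left_iff dvd_triv_left)
    qed
    ultimately show "G (l - j) = G j"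
      by (simp add: G_def)
  qed (use assms(5) in simp)
  also have "\<dots> = (\<Sum>i<d. F (i * (l div d)))"
    unfolding G_def using d assms(5) by (intro sum_torsion_reindex) auto
  also have "\<dots> \<ge> 0"
  proof -
    have "theta L (i * (l div d)) = 2 * pi * real i / real d" for i
      using d assms(5) by (auto simp: theta_def field_simps simp flip: assms(4))
    thus ?thesis
      using sum_poisson_nonneg[OF d(2) assms(8)] by (simp add: F_def)
  qed
  finally show ?thesis .
qed

end
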